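(* Let $X$ be a regular topological space. Write $(L,(<\kappa,B))$ for "$X$ is Lindelöf and $X$ is a union of fewer than $\kappa$ subspaces each of which has property $B$". Then all of the following implications hold for $X$: (1) $(L,(<\mathfrak{b},SH))$ implies $(L,(<\mathfrak{d},SH))$; (2) $(L,(<\mathfrak{b},SH))$ implies $(L,(<\mathfrak{b},SM))$; (3) $(L,(<\mathfrak{d},SH))$ implies that $X$ is Menger; (4) $(L,(<\mathfrak{b},SH))$ implies that $X$ is Hurewicz; (5) $(L,(<\mathfrak{b},SM))$ implies that $X$ is Menger; (6) if $X$ is Hurewicz then $X$ is Menger. Here $SH$ means star-Hurewicz and $SM$ means star-Menger.
   Context: Regular spaces are assumed to be $T_1$. For a family $\mathcal{U}$ of subsets of $X$ and $A\subseteq X$, $St(A,\mathcal{U})=\bigcup\{U\in\mathcal{U}: U\cap A\neq\emptyset\}$. A space $X$ is: - Menger if for each sequence $\{\mathcal{U}_n:n\in\omega\}$ of open covers of $X$ there are finite $\mathcal{V}_n\subseteq\mathcal{U}_n$ such that $\{\bigcup\mathcal{V}_n:n\in\omega\}$ covers $X$; - Hurewicz if for each such sequence there are finite $\mathcal{V}_n\subseteq\mathcal{U}_n$ such that each $x\in X$ belongs to $\bigcup\mathcal{V}_n$ for all but finitely many $n$; - star-Menger ($SM$) if for each such sequence there are finite $\mathcal{V}_n\subseteq\mathcal{U}_n$ such that $\{St(\bigcup\mathcal{V}_n,\mathcal{U}_n):n\in\omega\}$ covers $X$; - star-Hurewicz ($SH$) if for each such sequence there are finite $\mathcal{V}_n\subseteq\mathcal{U}_n$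 such that each $x\in X$ belongs to $St(\bigcup\mathcal{V}_n,\mathcal{U}_n)$ for all but finitely many $n$. For $f,g\in\omega^\omega$, $f\leq^* g$ means $f(n)\leq g(n)$ for all but finitely many $n$. $\mathfrak{b}$ is the least cardinality of a subset of $\omega^\omega$ that is unbounded with respect to $\leq^*$; $\mathfrak{d}$ is the least cardinality of a set $D\subseteq\omega^\omega$ that is dominating (every $g\in\omega^\omega$ satisfies $g\leq^* f$ for some $f\in D$). *)

theory Defs
  imports "HOL-Analysis.Analysis"
begin

unbundle cardinal_syntax

definition open_cover :: "'a topology \<Rightarrow> 'a set set \<Rightarrow> bool" where
  "open_cover X \<U> \<longleftrightarrow> (\<forall>U\<in>\<U>. openin X U) \<and> \<Union>\<U> = topspace X"

definition St :: "'a set \<Rightarrow> 'a set set \<Rightarrow> 'a set" where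
  "St A \<U> = \<Union>{U \<in> \<U>. U \<inter> A \<noteq> {}}"

definition Menger_space :: "'a topology \<Rightarrow> bool" where
  "Menger_space X \<longleftrightarrow>
     (\<forall>\<U>::nat \<Rightarrow> 'a set set. (\<forall>n. open_cover X (\<U> n)) \<longrightarrow>
        (\<exists>\<V>. (\<forall>n. finite (\<V> n) \<and> \<V> n \<subseteq> \<U> n) \<and>
             topspace X \<subseteq> (\<Union>n. \<Union>(\<V> n))))"

definition Hurewicz_space :: "'a topology \<Rightarrow> bool" where
  "Hurewicz_space X \<longleftrightarrow>
     (\<forall>\<U>::nat \<Rightarrow> 'a set set. (\<forall>n. open_cover X (\<U> n)) \<longrightarrow>
        (\<exists>\<V>. (\<forall>n. finite (\<V> n) \<and> \<V> n \<subseteq> \<U> n) \<and>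
             (\<forall>x\<in>topspace X. \<forall>\<^sub>\<infinity>n. x \<in> \<Union>(\<V> n))))"

definition star_Menger_space :: "'a topology \<Rightarrow> bool" where
  "star_Menger_space X \<longleftrightarrow>
     (\<forall>\<U>::nat \<Rightarrow> 'a set set. (\<forall>n. open_cover X (\<U> n)) \<longrightarrow>
        (\<exists>\<V>. (\<forall>n. finite (\<V> n) \<and> \<V> n \<subseteq> \<U> n) \<and>
             topspace X \<subseteq> (\<Union>n. St (\<Union>(\<V> n)) (\<U> n))))"

definition star_Hurewicz_space :: "'a topology \<Rightarrow> bool" where
  "star_Hurewicz_space X \<longleftrightarrow>
     (\<forall>\<U>::nat \<Rightarrow> 'a set set. (\<forall>n. open_cover X (\<U> n)) \<longrightarrow>
        (\<exists>\<V>. (\<forall>n. finite (\<V> n) \<and> \<V> n \<subseteq> \<U> n) \<and>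
             (\<forall>x\<in>topspace X. \<forall>\<^sub>\<infinity>n. x \<in> St (\<Union>(\<V> n)) (\<U> n))))"

definition le_star :: "(nat \<Rightarrow> nat) \<Rightarrow> (nat \<Rightarrow> nat) \<Rightarrow> bool" (infix \<open>\<le>\<^sup>*\<close> 50) where
  "f \<le>\<^sup>* g \<longleftrightarrow> (\<forall>\<^sub>\<infinity>n. f n \<le> g n)"

definition unbounded_family :: "(nat \<Rightarrow> nat) set \<Rightarrow> bool" where
  "unbounded_family A \<longleftrightarrow> \<not> (\<exists>g. \<forall>f\<in>A. f \<le>\<^sup>* g)"

definition dominating_family :: "(nat \<Rightarrow> nat) set \<Rightarrow> bool" where
  "dominating_family D \<longleftrightarrow> (\<forall>g. \<exists>f\<in>D. g \<le>\<^sup>* f)"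

text \<open>
  A cardinal is a cardinal order relation, determined only up to \<open>=o\<close>.  The least cardinality
  of a set with property \<open>P\<close> is the cardinal \<open>|A|\<close> of some set \<open>A\<close> of minimal cardinality
  among those with \<open>P\<close>; it exists as soon as some set has property \<open>P\<close>.
\<close>

definition least_card :: "('a set \<Rightarrow> bool) \<Rightarrow> 'a rel" where
  "least_card P = (SOME r. \<exists>A. P A \<and> r = |A| \<and> (\<forall>B. P B \<longrightarrow> |A| \<le>o |B| ))"

definition bounding_number :: "(nat \<Rightarrow> nat) rel" (\<open>\<bb>\<close>) where
  "\<bb> = least_card unbounded_family"

definition dominating_number :: "(nat \<Rightarrow> nat) rel" (\<open>\<dd>\<close>) where
  "\<dd> = least_card dominating_family"

lemma least_card:
  assumes "P A0"
  shows "\<exists>A. P A \<and> least_card P = |A| \<and> (\<forall>B. P B \<longrightarrow> |A| \<le>o |B| )"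
proof -
  let ?R = "card_of ` Collect P"
  have "\<exists>r\<in>?R. \<forall>r'\<in>?R. r \<le>o r'"
    by (rule exists_minim_Card_order) (use assms card_of_Card_order in auto)
  then have "\<exists>r A. P A \<and> r = |A| \<and> (\<forall>B. P B \<longrightarrow> |A| \<le>o |B| )" by auto
  then show ?thesis unfolding least_card_def by (rule someI_ex)
qed

lemma dominating_family_UNIV: "dominating_family UNIV"
proof -
  have "g \<le>\<^sup>* g" for g
    by (simp add: le_star_def)
  then show ?thesis by (auto simp: dominating_family_def)
qed

lemma unbounded_family_UNIV: "unbounded_family UNIV"
proof -
  have "\<not> (\<lambda>n. Suc (g n)) \<le>\<^sup>* g" for g
    by (simp add: le_star_def)
  then show ?thesis by (auto simp: unbounded_family_def)
qed

lemmas bounding_number =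
  least_card[of unbounded_family, OF unbounded_family_UNIV, folded bounding_number_def]
lemmas dominating_number =
  least_card[of dominating_family, OF dominating_family_UNIV, folded dominating_number_def]

text \<open>\<open>L_fewer \<kappa> P X\<close> is the property written \<open>(L,(<\<kappa>,P))\<close>.\<close>

definition L_fewer :: "'k rel \<Rightarrow> ('a topology \<Rightarrow> bool) \<Rightarrow> 'a topology \<Rightarrow> bool" where
  "L_fewer \<kappa> P X \<longleftrightarrow>
     Lindelof_space X \<and>
     (\<exists>\<S>. |\<S>| <o \<kappa> \<and> \<Union>\<S> = topspace X \<and> (\<forall>S\<in>\<S>. P (subtopology X S)))"

end

theory Submission
  imports Defs
begin

text \<open>
  The topological content is one fact about a regular Lindeloef space: every open cover \<open>\<U>\<close>
  admits an open cover \<open>\<W>\<close> such that the star in \<open>\<W>\<close> of each member of \<open>\<W>\<close> lies in a finite union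
  of members of \<open>\<U>\<close> (\<open>regular_Lindelof_small_stars\<close>). Such a space is normal, so it is exhausted by
  an increasing sequence of open sets, each containing the closure of the previous one and each
  inside a finite union of members of \<open>\<U>\<close>; the differences of nearby stages form \<open>\<W>\<close>.

  Applying a star selection property of a subspace \<open>S\<close> to the traces of such covers \<open>\<W>\<close> removes the
  stars: for every sequence of open covers of the whole space, finitely many members of each
  cover can be selected so that the selections cover \<open>S\<close> in the Menger or in the Hurewicz sense.
  By the Lindeloef property each cover may be taken to be the union of an increasing sequence
  \<open>\<E> n 0 \<subseteq> \<E> n 1 \<subseteq> \<dots>\<close> of finite families, and a selection is then described by a function: \<open>S\<close> has
  some \<open>f\<close> such that every point of \<open>S\<close> lies in \<open>\<Union>(\<E> n (f n))\<close> for all but finitely many \<open>n\<close> if \<open>S\<close>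
  is star-Hurewicz, and for infinitely many \<open>n\<close> if \<open>S\<close> is star-Menger.

  It remains to treat all subspaces with one function \<open>g\<close>. With fewer than \<open>\<bb>\<close> subspaces, some
  \<open>g\<close> is eventually above all the functions \<open>f\<close>, so both "almost all" and "infinitely many" are
  inherited by \<open>g\<close>. With fewer than \<open>\<dd>\<close> subspaces, some \<open>g\<close> is eventually dominated by none of
  the functions \<open>f\<close>, so it exceeds each of them infinitely often; "almost all" for \<open>f\<close> then
  leaves "infinitely many" for \<open>g\<close>, which suffices for Menger.
\<close>

section \<open>Covers whose stars are small\<close>

lemma growing_finite_subfamilies:
  assumes "Lindelof_space X" and "open_cover X \<U>"
  obtains \<E> :: "nat \<Rightarrow> 'a set set"
  where "mono \<E>" and "\<And>k. finite (\<E> k)" and "\<And>k. \<E> k \<subseteq> \<U>" and "open_cover X (\<Union>k. \<E> k)"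
proof -
  obtain \<C> where \<C>: "countable \<C>" "\<C> \<subseteq> \<U>" "\<Union>\<C> = topspace X"
    using assms by (meson Lindelof_spaceD open_cover_def)
  define \<E> where "\<E> k = {U \<in> \<C>. to_nat_on \<C> U \<le> k}" for k
  have "finite (\<E> k)" for k
  proof -
    have "to_nat_on \<C> ` \<E> k \<subseteq> {..k}" by (auto simp: \<E>_def)
    moreover have "inj_on (to_nat_on \<C>) (\<E> k)"
      using inj_on_to_nat_on[OF \<C>(1)] by (rule inj_on_subset) (auto simp: \<E>_def)
    ultimately show ?thesis by (meson finite_atMost inj_on_finite)
  qed
  moreover have "mono \<E>" by (force simp: \<E>_def mono_def)
  moreover have "(\<Union>k. \<E> k) = \<C>" by (auto simp: \<E>_def)
  moreover have "\<E> k \<subseteq> \<U>" for k using \<C>(2) by (auto simp: \<E>_def)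
  moreover have "open_cover X (\<Union>k. \<E> k)"
    unfolding \<open>(\<Union>k. \<E> k) = \<C>\<close> using \<C> assms(2) by (auto simp: open_cover_def)
  ultimately show thesis by (intro that)
qed

lemma finite_subset_growing_union:
  fixes \<E> :: "nat \<Rightarrow> 'b set"
  assumes "mono \<E>" and "finite F" and "F \<subseteq> (\<Union>k. \<E> k)"
  shows "\<exists>k. F \<subseteq> \<E> k"
  using assms(2,3)
proof (induction F)
  case (insert x F)
  then obtain j k where "F \<subseteq> \<E> j" "x \<in> \<E> k" by auto
  then have "insert x F \<subseteq> \<E> (max j k)"
    using monoD[OF assms(1), of j "max j k"] monoD[OF assms(1), of k "max j k"] by auto
  then show ?case ..
qed simp

text \<open>
  A union of finitely many small neighbourhoods has its closure inside a finite union of members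
  of \<open>\<U>\<close>. Normality inserts between the two an open set that also has this property and swallows
  the closure of the previous stage.
\<close>

lemma regular_Lindelof_open_filtration:
  assumes "regular_space X" and "Lindelof_space X" and "open_cover X \<U>"
  obtains A :: "nat \<Rightarrow> 'a set"
  where "A 0 = {}" and "\<And>n. openin X (A n)" and "\<And>n. X closure_of A n \<subseteq> A (Suc n)"
    and "topspace X \<subseteq> (\<Union>n. A n)"
    and "\<And>n. \<exists>\<F>. finite \<F> \<and> \<F> \<subseteq> \<U> \<and> A n \<subseteq> \<Union>\<F>"
proof -
  have normal: "normal_space X"
    using assms by (simp add: regular_Lindelof_imp_normal_space)
  define small where
    "small A \<longleftrightarrow> openin X A \<and> (\<exists>\<F>. finite \<F> \<and> \<F> \<subseteq> \<U> \<and> X closure_of A \<subseteq> \<Union>\<F>)" for A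
  have "open_cover X (Collect small)"
    unfolding open_cover_def
  proof (intro conjI equalityI subsetI)
    show "\<forall>U\<in>Collect small. openin X U" by (simp add: small_def)
  next
    fix x assume "x \<in> \<Union>(Collect small)"
    then show "x \<in> topspace X"
      using openin_subset by (force simp: small_def)
  next
    fix x assume "x \<in> topspace X"
    then obtain U where U: "U \<in> \<U>" "openin X U" "x \<in> U"
      using assms(3) by (auto simp: open_cover_def)
    then obtain W C where W: "openin X W" "closedin X C" "x \<in> W" "W \<subseteq> C" "C \<subseteq> U"
      using assms(1)[folded neighbourhood_base_of_closedin]
      unfolding neighbourhood_base_of by meson
    then have "X closure_of W \<subseteq> \<Union>{U}"
      by (metis ccpo_Sup_singleton closure_of_minimal order_trans)
    then have "small W" using W U unfolding small_def by blast
    then show "x \<in> \<Union>(Collect small)" using W by blast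
  qed
  then obtain \<E> where \<E>: "mono \<E>" "\<And>k::nat. finite (\<E> k)" "\<And>k. \<E> k \<subseteq> Collect small"
      "open_cover X (\<Union>k. \<E> k)"
    using growing_finite_subfamilies[OF assms(2)] by metis
  have small_Un: "small (A \<union> B)" if "small A" "small B" for A B
  proof -
    from that obtain F G where F: "finite F" "F \<subseteq> \<U>" "X closure_of A \<subseteq> \<Union>F"
      and G: "finite G" "G \<subseteq> \<U>" "X closure_of B \<subseteq> \<Union>G"
      unfolding small_def by blast
    then have "finite (F \<union> G)" "F \<union> G \<subseteq> \<U>" "X closure_of (A \<union> B) \<subseteq> \<Union>(F \<union> G)"
      by auto
    then show ?thesis using that unfolding small_def by blast
  qed
  have small_empty: "small {}" unfolding small_def by auto
  have small_Union: "small (\<Union>\<G>)" if "finite \<G>" "\<G> \<subseteq> Collect small" for \<G>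
    using that by (induction \<G>) (auto simp: small_empty small_Un)
  have step: "\<exists>B. small B \<and> X closure_of A \<subseteq> B \<and> \<Union>(\<E> n) \<subseteq> B" if A: "small A" for A n
  proof -
    have AB: "small (A \<union> \<Union>(\<E> n))"
      using small_Un[OF A small_Union[OF \<E>(2,3)]] .
    then obtain \<F> where \<F>: "finite \<F>" "\<F> \<subseteq> \<U>" "X closure_of (A \<union> \<Union>(\<E> n)) \<subseteq> \<Union>\<F>"
      unfolding small_def by blast
    moreover have "openin X (\<Union>\<F>)" using \<F>(2) assms(3) by (intro openin_Union) (auto simp: open_cover_def)
    ultimately obtain B where B: "openin X B" "X closure_of (A \<union> \<Union>(\<E> n)) \<subseteq> B"
        "X closure_of B \<subseteq> \<Union>\<F>"
      using normal unfolding normal_space_alt by (meson closedin_closure_of)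
    have "A \<union> \<Union>(\<E> n) \<subseteq> X closure_of (A \<union> \<Union>(\<E> n))"
      using AB by (metis closure_of_subset openin_subset small_def)
    then have "\<Union>(\<E> n) \<subseteq> B" "X closure_of A \<subseteq> B" using B(2) by auto
    moreover have "small B" using B(1,3) \<F>(1,2) unfolding small_def by blast
    ultimately show ?thesis by blast
  qed
  have ex: "\<exists>A. \<forall>n. (small (A n) \<and> (n = 0 \<longrightarrow> A n = {})) \<and>
      (X closure_of A n \<subseteq> A (Suc n) \<and> \<Union>(\<E> n) \<subseteq> A (Suc n))"
    by (rule dependent_nat_choice) (use small_empty step in auto)
  from exE[OF ex] obtain A where
    stages: "\<forall>n. (small (A n) \<and> (n = 0 \<longrightarrow> A n = {})) \<and>
      (X closure_of A n \<subseteq> A (Suc n) \<and> \<Union>(\<E> n) \<subseteq> A (Suc n))" .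
  have A: "small (A n)" "A 0 = {}" "X closure_of A n \<subseteq> A (Suc n)"
      "\<Union>(\<E> n) \<subseteq> A (Suc n)" for n
    using stages by simp_all
  show thesis
  proof
    have "topspace X = (\<Union>n. \<Union>(\<E> n))" using \<E>(4) unfolding open_cover_def by blast
    then show "topspace X \<subseteq> (\<Union>n. A n)" using A(4) by blast
    show "\<exists>\<F>. finite \<F> \<and> \<F> \<subseteq> \<U> \<and> A n \<subseteq> \<Union>\<F>" for n
      using A(1)[of n] closure_of_subset[OF openin_subset] unfolding small_def
      by (meson order_trans)
  qed (use A in \<open>auto simp: small_def\<close>)
qed

text \<open>
  The members of the new cover are the shells between one stage of the filtration and the closure
  of the stage two below. The \<open>j\<close>-th shell avoids stage \<open>j\<close>, while the \<open>i\<close>-th one lies in stage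
  \<open>i + 2\<close>; so only the shells up to index \<open>i + 1\<close> can meet the \<open>i\<close>-th one, and all these lie in
  stage \<open>i + 3\<close>.
\<close>

lemma regular_Lindelof_small_stars:
  assumes "regular_space X" and "Lindelof_space X" and "open_cover X \<U>"
  obtains \<W> where "open_cover X \<W>"
    and "\<And>W. W \<in> \<W> \<Longrightarrow> \<exists>\<F>. finite \<F> \<and> \<F> \<subseteq> \<U> \<and> St W \<W> \<subseteq> \<Union>\<F>"
proof -
  obtain A :: "nat \<Rightarrow> 'a set"
    where A: "A 0 = {}" "\<And>n. openin X (A n)" "\<And>n. X closure_of A n \<subseteq> A (Suc n)"
      "topspace X \<subseteq> (\<Union>n. A n)"
      "\<And>n. \<exists>\<F>. finite \<F> \<and> \<F> \<subseteq> \<U> \<and> A n \<subseteq> \<Union>\<F>"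
    using regular_Lindelof_open_filtration[OF assms] by metis
  have cl: "A n \<subseteq> X closure_of A n" for n
    using A(2) by (simp add: closure_of_subset openin_subset)
  have mono: "A m \<subseteq> A n" if "m \<le> n" for m n
    using that by (rule lift_Suc_mono_le[rotated]) (use A(3) cl in blast)
  define G where "G n = A (n + 2) - X closure_of A n" for n
  have "open_cover X (range G)"
    unfolding open_cover_def
  proof (intro conjI equalityI subsetI)
    show "\<forall>U\<in>range G. openin X U" using A(2) by (auto simp: G_def)
    show "x \<in> topspace X" if "x \<in> \<Union>(range G)" for x
      using that A(2) openin_subset by (force simp: G_def)
  next
    fix x assume "x \<in> topspace X"
    then have ex: "\<exists>n. x \<in> A n" using A(4) by blast
    define m where "m = (LEAST n. x \<in> A n)"
    have m: "x \<in> A m" using ex unfolding m_def by (rule LeastI_ex)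
    have least: "x \<notin> A n" if "n < m" for n using that not_less_Least unfolding m_def by blast
    have "m > 0" using m A(1) by (cases m) auto
    \<comment> \<open>Truncated subtraction is meant here: for \<open>m = 1\<close> the index is \<open>0\<close>, and as \<open>A 0\<close> is empty,
      nothing is removed from \<open>A 2\<close>.\<close>
    have "x \<in> G (m - 2)"
    proof (cases "m = 1")
      case True
      then show ?thesis using m mono[of 1 2] A(1) by (auto simp: G_def numeral_2_eq_2)
    next
      case False
      then have "Suc (m - 2) < m" "m - 2 + 2 = m" using \<open>m > 0\<close> by auto
      then show ?thesis using m least[of "Suc (m - 2)"] A(3)[of "m - 2"] by (auto simp: G_def)
    qed
    then show "x \<in> \<Union>(range G)" by blast
  qed
  moreover have "\<exists>\<F>. finite \<F> \<and> \<F> \<subseteq> \<U> \<and> St W (range G) \<subseteq> \<Union>\<F>" if W: "W \<in> range G" for W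
  proof -
    obtain i where i: "W = G i" using W by blast
    have "G j \<subseteq> A (i + 3)" if "G j \<inter> G i \<noteq> {}" for j
    proof (cases "j \<le> i + 1")
      case True
      then show ?thesis using mono[of "j + 2" "i + 3"] by (auto simp: G_def)
    next
      case False
      then show ?thesis using that mono[of "i + 2" j] cl[of j] by (auto simp: G_def)
    qed
    then have "St W (range G) \<subseteq> A (i + 3)" unfolding i St_def by blast
    then show ?thesis using A(5)[of "i + 3"] by (meson order_trans)
  qed
  ultimately show thesis by (rule that)
qed

text \<open>
  Traces on a subspace only shrink stars, so a star condition on the subspace controls how it is
  covered by open sets of the whole space.
\<close>

lemma subspace_cover_with_small_stars:
  assumes "regular_space X" and "Lindelof_space X"
    and "mono \<E>" and "open_cover X (\<Union>k::nat. \<E> k)"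
  shows "\<exists>\<W>. open_cover (subtopology X S) \<W> \<and>
    (\<forall>\<V>. finite \<V> \<longrightarrow> \<V> \<subseteq> \<W> \<longrightarrow> (\<exists>k. St (\<Union>\<V>) \<W> \<subseteq> \<Union>(\<E> k)))"
proof -
  obtain \<W> where \<W>: "open_cover X \<W>"
    "\<And>W. W \<in> \<W> \<Longrightarrow> \<exists>\<F>. finite \<F> \<and> \<F> \<subseteq> (\<Union>k. \<E> k) \<and> St W \<W> \<subseteq> \<Union>\<F>"
    using regular_Lindelof_small_stars[OF assms(1,2,4)] by metis
  define \<T> where "\<T> = (\<lambda>W. W \<inter> S) ` \<W>"
  have "open_cover (subtopology X S) \<T>"
    using \<W>(1) by (auto simp: open_cover_def \<T>_def openin_subtopology)
  moreover have "\<exists>k. St (\<Union>\<V>) \<T> \<subseteq> \<Union>(\<E> k)" if \<V>: "finite \<V>" "\<V> \<subseteq> \<T>" for \<V>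
  proof -
    have "\<exists>\<F>. finite \<F> \<and> \<F> \<subseteq> (\<Union>k. \<E> k) \<and> St V \<T> \<subseteq> \<Union>\<F>" if V: "V \<in> \<T>" for V
    proof -
      obtain W where W: "W \<in> \<W>" "V = W \<inter> S" using V by (auto simp: \<T>_def)
      have "St V \<T> \<subseteq> St W \<W>" using W by (auto simp: St_def \<T>_def)
      then show ?thesis using \<W>(2)[OF W(1)] by (meson order_trans)
    qed
    then obtain \<F> where \<F>: "\<And>V. V \<in> \<T> \<Longrightarrow>
        finite (\<F> V) \<and> \<F> V \<subseteq> (\<Union>k. \<E> k) \<and> St V \<T> \<subseteq> \<Union>(\<F> V)"
      by metis
    have "finite (\<Union>V\<in>\<V>. \<F> V)" "(\<Union>V\<in>\<V>. \<F> V) \<subseteq> (\<Union>k. \<E> k)" using \<V> \<F> by blast+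
    then obtain k where k: "(\<Union>V\<in>\<V>. \<F> V) \<subseteq> \<E> k"
      using finite_subset_growing_union[OF assms(3)] by blast
    have "St (\<Union>\<V>) \<T> \<subseteq> (\<Union>V\<in>\<V>. St V \<T>)" by (auto simp: St_def)
    also have "\<dots> \<subseteq> \<Union>(\<E> k)" using \<F> \<V> k by blast
    finally show ?thesis ..
  qed
  ultimately show ?thesis by blast
qed

section \<open>Functions attached to subspaces\<close>

lemma star_Hurewicz_subspace_function:
  fixes \<E> :: "nat \<Rightarrow> nat \<Rightarrow> 'a set set"
  assumes "regular_space X" and "Lindelof_space X" and "S \<subseteq> topspace X"
    and "star_Hurewicz_space (subtopology X S)"
    and "\<And>n. mono (\<E> n)" and "\<And>n. open_cover X (\<Union>k::nat. \<E> n k)"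
  shows "\<exists>f. \<forall>x\<in>S. \<forall>\<^sub>\<infinity>n. x \<in> \<Union>(\<E> n (f n))"
proof -
  obtain \<W> where \<W>: "\<And>n. open_cover (subtopology X S) (\<W> n)"
      "\<And>n \<V>. finite \<V> \<Longrightarrow> \<V> \<subseteq> \<W> n \<Longrightarrow> \<exists>k. St (\<Union>\<V>) (\<W> n) \<subseteq> \<Union>(\<E> n k)"
    using subspace_cover_with_small_stars[OF assms(1,2,5,6)] by metis
  then obtain \<V> where \<V>: "\<And>n. finite (\<V> n) \<and> \<V> n \<subseteq> \<W> n"
      "\<And>x. x \<in> S \<Longrightarrow> \<forall>\<^sub>\<infinity>n. x \<in> St (\<Union>(\<V> n)) (\<W> n)"
    using assms(4)[unfolded star_Hurewicz_space_def, rule_format, of \<W>]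
      topspace_subtopology_subset[OF assms(3)]
    by metis
  have "\<forall>n. \<exists>k. St (\<Union>(\<V> n)) (\<W> n) \<subseteq> \<Union>(\<E> n k)"
    using \<W>(2) \<V>(1) by blast
  then obtain f where f: "\<And>n. St (\<Union>(\<V> n)) (\<W> n) \<subseteq> \<Union>(\<E> n (f n))"
    by metis
  have "\<forall>x\<in>S. \<forall>\<^sub>\<infinity>n. x \<in> \<Union>(\<E> n (f n))"
  proof
    fix x assume "x \<in> S"
    then have "\<forall>\<^sub>\<infinity>n. x \<in> St (\<Union>(\<V> n)) (\<W> n)" by (rule \<V>(2))
    then show "\<forall>\<^sub>\<infinity>n. x \<in> \<Union>(\<E> n (f n))"
      by (rule MOST_mono) (use f in blast)
  qed
  then show ?thesis by (intro exI[of _ f])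
qed

text \<open>
  The star-Menger property covers each point only once, which would be lost when \<open>f\<close> is later
  replaced by a function that bounds it only from some index on. Applying the property to every
  tail of the sequence of covers, and taking at each index the maximum over the finitely many
  tails that have begun, covers each point infinitely often.
\<close>

lemma star_Menger_subspace_function:
  fixes \<E> :: "nat \<Rightarrow> nat \<Rightarrow> 'a set set"
  assumes "regular_space X" and "Lindelof_space X" and "S \<subseteq> topspace X"
    and "star_Menger_space (subtopology X S)"
    and "\<And>n. mono (\<E> n)" and "\<And>n. open_cover X (\<Union>k::nat. \<E> n k)"
  shows "\<exists>f. \<forall>x\<in>S. \<exists>\<^sub>\<infinity>n. x \<in> \<Union>(\<E> n (f n))"
proof -
  obtain \<W> where \<W>: "\<And>n. open_cover (subtopology X S) (\<W> n)"
      "\<And>n \<V>. finite \<V> \<Longrightarrow> \<V> \<subseteq> \<W> n \<Longrightarrow> \<exists>k. St (\<Union>\<V>) (\<W> n) \<subseteq> \<Union>(\<E> n k)"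
    using subspace_cover_with_small_stars[OF assms(1,2,5,6)] by metis
  have "\<exists>f. \<forall>x\<in>S. \<exists>n. x \<in> \<Union>(\<E> (n + m) (f n))" for m
  proof -
    have "\<exists>\<V>. (\<forall>n. finite (\<V> n) \<and> \<V> n \<subseteq> \<W> (n + m)) \<and>
        topspace (subtopology X S) \<subseteq> (\<Union>n. St (\<Union>(\<V> n)) (\<W> (n + m)))"
      using assms(4)[unfolded star_Menger_space_def, rule_format, of "\<lambda>n. \<W> (n + m)"] \<W>(1)
      by blast
    then obtain \<V> where \<V>: "\<And>n. finite (\<V> n) \<and> \<V> n \<subseteq> \<W> (n + m)"
        "S \<subseteq> (\<Union>n. St (\<Union>(\<V> n)) (\<W> (n + m)))"
      using assms(3) by (auto simp: Int_absorb1)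
    have "\<forall>n. \<exists>k. St (\<Union>(\<V> n)) (\<W> (n + m)) \<subseteq> \<Union>(\<E> (n + m) k)"
      using \<W>(2) \<V>(1) by blast
    then obtain f where f: "\<And>n. St (\<Union>(\<V> n)) (\<W> (n + m)) \<subseteq> \<Union>(\<E> (n + m) (f n))"
      by metis
    have "\<forall>x\<in>S. \<exists>n. x \<in> \<Union>(\<E> (n + m) (f n))" using \<V>(2) f by blast
    then show ?thesis by (intro exI[of _ f])
  qed
  then obtain h where h: "\<And>m x. x \<in> S \<Longrightarrow> \<exists>n. x \<in> \<Union>(\<E> (n + m) (h m n))"
    by metis
  define f where "f n = Max ((\<lambda>m. h m (n - m)) ` {..n})" for n
  have "\<exists>\<^sub>\<infinity>n. x \<in> \<Union>(\<E> n (f n))" if x: "x \<in> S" for x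
    unfolding INFM_nat_le
  proof
    fix m
    obtain n where n: "x \<in> \<Union>(\<E> (n + m) (h m n))" using h[OF x, of m] by (rule exE)
    have "h m (n + m - m) \<le> f (n + m)" unfolding f_def
      by (intro Max_ge imageI) auto
    then have "\<E> (n + m) (h m n) \<subseteq> \<E> (n + m) (f (n + m))"
      using monoD[OF assms(5)] by simp
    then show "\<exists>n\<ge>m. x \<in> \<Union>(\<E> n (f n))"
      using n by (metis Sup_subset_mono le_add2 subsetD)
  qed
  then show ?thesis by (intro exI[of _ f] ballI)
qed

section \<open>Families smaller than the bounding and the dominating number\<close>

lemma fewer_than_bounding_number:
  fixes f :: "'i \<Rightarrow> nat \<Rightarrow> nat"
  assumes "|I| <o \<bb>"
  obtains g where "\<And>i. i \<in> I \<Longrightarrow> f i \<le>\<^sup>* g"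
proof -
  have "\<not> unbounded_family (f ` I)"
    using bounding_number assms card_of_image[of f I]
    by (metis not_ordLess_ordLeq ordLeq_transitive)
  then show thesis using that by (auto simp: unbounded_family_def)
qed

lemma fewer_than_dominating_number:
  fixes f :: "'i \<Rightarrow> nat \<Rightarrow> nat"
  assumes "|I| <o \<dd>"
  obtains g where "\<And>i. i \<in> I \<Longrightarrow> \<not> g \<le>\<^sup>* f i"
proof -
  have "\<not> dominating_family (f ` I)"
    using dominating_number assms card_of_image[of f I]
    by (metis not_ordLess_ordLeq ordLeq_transitive)
  then show thesis using that by (auto simp: dominating_family_def)
qed

lemma dominating_imp_unbounded_family:
  assumes "dominating_family D"
  shows "unbounded_family D"
  unfolding unbounded_family_def
proof
  assume "\<exists>g. \<forall>f\<in>D. f \<le>\<^sup>* g"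
  then obtain g where g: "\<And>f. f \<in> D \<Longrightarrow> f \<le>\<^sup>* g" by blast
  obtain f where f: "f \<in> D" "(\<lambda>n. Suc (g n)) \<le>\<^sup>* f"
    using assms unfolding dominating_family_def by blast
  have "\<forall>\<^sub>\<infinity>n. Suc (g n) \<le> f n \<and> f n \<le> g n"
    using f g[OF f(1)] by (simp add: le_star_def MOST_conj_distrib)
  then show False by (auto simp: MOST_nat_le)
qed

lemma bounding_number_le_dominating_number: "\<bb> \<le>o \<dd>"
  using bounding_number dominating_number dominating_imp_unbounded_family by metis

section \<open>From subspaces to the whole space\<close>

lemma star_Hurewicz_imp_star_Menger:
  assumes "star_Hurewicz_space X"
  shows "star_Menger_space X"
  unfolding star_Menger_space_def
proof (intro allI impI)
  fix \<U> :: "nat \<Rightarrow> 'a set set"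
  assume "\<forall>n. open_cover X (\<U> n)"
  then obtain \<V> where "\<forall>n. finite (\<V> n) \<and> \<V> n \<subseteq> \<U> n"
      and *: "\<And>x. x \<in> topspace X \<Longrightarrow> \<forall>\<^sub>\<infinity>n. x \<in> St (\<Union>(\<V> n)) (\<U> n)"
    using assms unfolding star_Hurewicz_space_def by metis
  moreover have "topspace X \<subseteq> (\<Union>n. St (\<Union>(\<V> n)) (\<U> n))"
    using * by (force simp: MOST_nat_le)
  ultimately show "\<exists>\<V>. (\<forall>n. finite (\<V> n) \<and> \<V> n \<subseteq> \<U> n) \<and>
      topspace X \<subseteq> (\<Union>n. St (\<Union>(\<V> n)) (\<U> n))" by blast
qed

lemma Hurewicz_imp_Menger:
  assumes "Hurewicz_space X"
  shows "Menger_space X"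
  unfolding Menger_space_def
proof (intro allI impI)
  fix \<U> :: "nat \<Rightarrow> 'a set set"
  assume "\<forall>n. open_cover X (\<U> n)"
  then obtain \<V> where "\<forall>n. finite (\<V> n) \<and> \<V> n \<subseteq> \<U> n"
      and *: "\<And>x. x \<in> topspace X \<Longrightarrow> \<forall>\<^sub>\<infinity>n. x \<in> \<Union>(\<V> n)"
    using assms unfolding Hurewicz_space_def by metis
  moreover have "topspace X \<subseteq> (\<Union>n. \<Union>(\<V> n))"
    using * by (force simp: MOST_nat_le)
  ultimately show "\<exists>\<V>. (\<forall>n. finite (\<V> n) \<and> \<V> n \<subseteq> \<U> n) \<and>
      topspace X \<subseteq> (\<Union>n. \<Union>(\<V> n))" by blast
qed

text \<open>
  A sequence of open covers of a Lindeloef space can be replaced by growing finite pieces, so a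
  finite selection becomes a single function.
\<close>

lemma Lindelof_Menger_by_functions:
  assumes "Lindelof_space X"
    and "\<And>\<E> :: nat \<Rightarrow> nat \<Rightarrow> 'a set set.
      (\<And>n. mono (\<E> n)) \<Longrightarrow> (\<And>n. open_cover X (\<Union>k. \<E> n k)) \<Longrightarrow>
      \<exists>g. \<forall>x\<in>topspace X. \<exists>n. x \<in> \<Union>(\<E> n (g n))"
  shows "Menger_space X"
  unfolding Menger_space_def
proof (intro allI impI)
  fix \<U> :: "nat \<Rightarrow> 'a set set"
  assume "\<forall>n. open_cover X (\<U> n)"
  then have "\<forall>n. \<exists>\<E>. mono \<E> \<and> (\<forall>k::nat. finite (\<E> k) \<and> \<E> k \<subseteq> \<U> n) \<and> open_cover X (\<Union>k. \<E> k)"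
    using growing_finite_subfamilies[OF assms(1)] by metis
  then obtain \<E> where \<E>: "\<And>n. mono (\<E> n)" "\<And>n k::nat. finite (\<E> n k) \<and> \<E> n k \<subseteq> \<U> n"
      "\<And>n. open_cover X (\<Union>k. \<E> n k)"
    by metis
  obtain g where "\<forall>x\<in>topspace X. \<exists>n. x \<in> \<Union>(\<E> n (g n))"
    using assms(2)[of \<E>, OF \<E>(1,3)] by blast
  then have "topspace X \<subseteq> (\<Union>n. \<Union>(\<E> n (g n)))" by blast
  then show "\<exists>\<V>. (\<forall>n. finite (\<V> n) \<and> \<V> n \<subseteq> \<U> n) \<and> topspace X \<subseteq> (\<Union>n. \<Union>(\<V> n))"
    using \<E>(2) by (intro exI[of _ "\<lambda>n. \<E> n (g n)"] conjI) simp_all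
qed

lemma Lindelof_Hurewicz_by_functions:
  assumes "Lindelof_space X"
    and "\<And>\<E> :: nat \<Rightarrow> nat \<Rightarrow> 'a set set.
      (\<And>n. mono (\<E> n)) \<Longrightarrow> (\<And>n. open_cover X (\<Union>k. \<E> n k)) \<Longrightarrow>
      \<exists>g. \<forall>x\<in>topspace X. \<forall>\<^sub>\<infinity>n. x \<in> \<Union>(\<E> n (g n))"
  shows "Hurewicz_space X"
  unfolding Hurewicz_space_def
proof (intro allI impI)
  fix \<U> :: "nat \<Rightarrow> 'a set set"
  assume "\<forall>n. open_cover X (\<U> n)"
  then have "\<forall>n. \<exists>\<E>. mono \<E> \<and> (\<forall>k::nat. finite (\<E> k) \<and> \<E> k \<subseteq> \<U> n) \<and> open_cover X (\<Union>k. \<E> k)"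
    using growing_finite_subfamilies[OF assms(1)] by metis
  then obtain \<E> where \<E>: "\<And>n. mono (\<E> n)" "\<And>n k::nat. finite (\<E> n k) \<and> \<E> n k \<subseteq> \<U> n"
      "\<And>n. open_cover X (\<Union>k. \<E> n k)"
    by metis
  obtain g where "\<forall>x\<in>topspace X. \<forall>\<^sub>\<infinity>n. x \<in> \<Union>(\<E> n (g n))"
    using assms(2)[of \<E>, OF \<E>(1,3)] by blast
  then show "\<exists>\<V>. (\<forall>n. finite (\<V> n) \<and> \<V> n \<subseteq> \<U> n) \<and>
      (\<forall>x\<in>topspace X. \<forall>\<^sub>\<infinity>n. x \<in> \<Union>(\<V> n))"
    using \<E>(2) by (intro exI[of _ "\<lambda>n. \<E> n (g n)"] conjI) simp_all
qed

lemma L_fewer_bounding_star_Hurewicz_imp_Hurewicz: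
  assumes "regular_space X" and "L_fewer \<bb> star_Hurewicz_space X"
  shows "Hurewicz_space X"
proof -
  obtain \<S> where L: "Lindelof_space X" and \<S>: "|\<S>| <o \<bb>" "\<Union>\<S> = topspace X"
      "\<And>S. S \<in> \<S> \<Longrightarrow> star_Hurewicz_space (subtopology X S)"
    using assms(2) unfolding L_fewer_def by blast
  from L show ?thesis
  proof (rule Lindelof_Hurewicz_by_functions)
    fix \<E> :: "nat \<Rightarrow> nat \<Rightarrow> 'a set set"
    assume \<E>: "\<And>n. mono (\<E> n)" "\<And>n. open_cover X (\<Union>k. \<E> n k)"
    have "\<forall>S\<in>\<S>. \<exists>f. \<forall>x\<in>S. \<forall>\<^sub>\<infinity>n. x \<in> \<Union>(\<E> n (f n))"
      by (intro ballI star_Hurewicz_subspace_function[OF assms(1) L _ \<S>(3) \<E>])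
        (use \<S>(2) in auto)
    from bchoice[OF this] obtain f
      where f: "\<And>S x. S \<in> \<S> \<Longrightarrow> x \<in> S \<Longrightarrow> \<forall>\<^sub>\<infinity>n. x \<in> \<Union>(\<E> n (f S n))"
      by blast
    obtain g where g: "\<And>S. S \<in> \<S> \<Longrightarrow> f S \<le>\<^sup>* g"
      using fewer_than_bounding_number[OF \<S>(1)] by metis
    have "\<forall>\<^sub>\<infinity>n. x \<in> \<Union>(\<E> n (g n))" if "S \<in> \<S>" "x \<in> S" for S x
      using MOST_conjI[OF f[OF that] g[OF that(1), unfolded le_star_def]]
      by (rule MOST_mono) (meson Sup_subset_mono \<E>(1) monoD subsetD)
    then show "\<exists>g. \<forall>x\<in>topspace X. \<forall>\<^sub>\<infinity>n. x \<in> \<Union>(\<E> n (g n))"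
      using \<S>(2) by (intro exI[of _ g]) blast
  qed
qed

lemma L_fewer_dominating_star_Hurewicz_imp_Menger:
  assumes "regular_space X" and "L_fewer \<dd> star_Hurewicz_space X"
  shows "Menger_space X"
proof -
  obtain \<S> where L: "Lindelof_space X" and \<S>: "|\<S>| <o \<dd>" "\<Union>\<S> = topspace X"
      "\<And>S. S \<in> \<S> \<Longrightarrow> star_Hurewicz_space (subtopology X S)"
    using assms(2) unfolding L_fewer_def by blast
  from L show ?thesis
  proof (rule Lindelof_Menger_by_functions)
    fix \<E> :: "nat \<Rightarrow> nat \<Rightarrow> 'a set set"
    assume \<E>: "\<And>n. mono (\<E> n)" "\<And>n. open_cover X (\<Union>k. \<E> n k)"
    have "\<forall>S\<in>\<S>. \<exists>f. \<forall>x\<in>S. \<forall>\<^sub>\<infinity>n. x \<in> \<Union>(\<E> n (f n))"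
      by (intro ballI star_Hurewicz_subspace_function[OF assms(1) L _ \<S>(3) \<E>])
        (use \<S>(2) in auto)
    from bchoice[OF this] obtain f
      where f: "\<And>S x. S \<in> \<S> \<Longrightarrow> x \<in> S \<Longrightarrow> \<forall>\<^sub>\<infinity>n. x \<in> \<Union>(\<E> n (f S n))"
      by blast
    obtain g where g: "\<And>S. S \<in> \<S> \<Longrightarrow> \<not> g \<le>\<^sup>* f S"
      using fewer_than_dominating_number[OF \<S>(1)] by metis
    have "\<exists>n. x \<in> \<Union>(\<E> n (g n))" if "S \<in> \<S>" "x \<in> S" for S x
    proof -
      have "\<exists>\<^sub>\<infinity>n. f S n \<le> g n"
        using g[OF that(1)] unfolding le_star_def not_MOST
        by (rule INFM_mono) simp
      then have "\<exists>\<^sub>\<infinity>n. f S n \<le> g n \<and> x \<in> \<Union>(\<E> n (f S n))"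
        using f[OF that] by (rule INFM_conjI)
      from INFM_EX[OF this] obtain n where "f S n \<le> g n" "x \<in> \<Union>(\<E> n (f S n))"
        by (elim exE conjE)
      then show ?thesis using monoD[OF \<E>(1)[of n], of "f S n" "g n"] by blast
    qed
    then show "\<exists>g. \<forall>x\<in>topspace X. \<exists>n. x \<in> \<Union>(\<E> n (g n))"
      using \<S>(2) by (intro exI[of _ g]) blast
  qed
qed

lemma L_fewer_bounding_star_Menger_imp_Menger:
  assumes "regular_space X" and "L_fewer \<bb> star_Menger_space X"
  shows "Menger_space X"
proof -
  obtain \<S> where L: "Lindelof_space X" and \<S>: "|\<S>| <o \<bb>" "\<Union>\<S> = topspace X"
      "\<And>S. S \<in> \<S> \<Longrightarrow> star_Menger_space (subtopology X S)"
    using assms(2) unfolding L_fewer_def by blast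
  from L show ?thesis
  proof (rule Lindelof_Menger_by_functions)
    fix \<E> :: "nat \<Rightarrow> nat \<Rightarrow> 'a set set"
    assume \<E>: "\<And>n. mono (\<E> n)" "\<And>n. open_cover X (\<Union>k. \<E> n k)"
    have "\<forall>S\<in>\<S>. \<exists>f. \<forall>x\<in>S. \<exists>\<^sub>\<infinity>n. x \<in> \<Union>(\<E> n (f n))"
      by (intro ballI star_Menger_subspace_function[OF assms(1) L _ \<S>(3) \<E>])
        (use \<S>(2) in auto)
    from bchoice[OF this] obtain f
      where f: "\<And>S x. S \<in> \<S> \<Longrightarrow> x \<in> S \<Longrightarrow> \<exists>\<^sub>\<infinity>n. x \<in> \<Union>(\<E> n (f S n))"
      by blast
    obtain g where g: "\<And>S. S \<in> \<S> \<Longrightarrow> f S \<le>\<^sup>* g"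
      using fewer_than_bounding_number[OF \<S>(1)] by metis
    have "\<exists>n. x \<in> \<Union>(\<E> n (g n))" if "S \<in> \<S>" "x \<in> S" for S x
    proof -
      have "\<exists>\<^sub>\<infinity>n. x \<in> \<Union>(\<E> n (f S n)) \<and> f S n \<le> g n"
        using f[OF that] g[OF that(1), unfolded le_star_def] by (rule INFM_conjI)
      from INFM_EX[OF this] obtain n where "x \<in> \<Union>(\<E> n (f S n))" "f S n \<le> g n"
        by (elim exE conjE)
      then show ?thesis using monoD[OF \<E>(1)[of n], of "f S n" "g n"] by blast
    qed
    then show "\<exists>g. \<forall>x\<in>topspace X. \<exists>n. x \<in> \<Union>(\<E> n (g n))"
      using \<S>(2) by (intro exI[of _ g]) blast
  qed
qed

theorem theorem2p2:
  fixes X :: "'a topology"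
  assumes "regular_space X" and "t1_space X"
  shows "(L_fewer \<bb> star_Hurewicz_space X \<longrightarrow> L_fewer \<dd> star_Hurewicz_space X) \<and>
         (L_fewer \<bb> star_Hurewicz_space X \<longrightarrow> L_fewer \<bb> star_Menger_space X) \<and>
         (L_fewer \<dd> star_Hurewicz_space X \<longrightarrow> Menger_space X) \<and>
         (L_fewer \<bb> star_Hurewicz_space X \<longrightarrow> Hurewicz_space X) \<and>
         (L_fewer \<bb> star_Menger_space X \<longrightarrow> Menger_space X) \<and>
         (Hurewicz_space X \<longrightarrow> Menger_space X)"
proof (intro conjI impI)
  show "L_fewer \<dd> star_Hurewicz_space X" if "L_fewer \<bb> star_Hurewicz_space X"
    using that bounding_number_le_dominating_number unfolding L_fewer_def
    by (meson ordLess_ordLeq_trans)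
  show "L_fewer \<bb> star_Menger_space X" if "L_fewer \<bb> star_Hurewicz_space X"
    using that star_Hurewicz_imp_star_Menger unfolding L_fewer_def by blast
qed (use assms(1) L_fewer_dominating_star_Hurewicz_imp_Menger
      L_fewer_bounding_star_Hurewicz_imp_Hurewicz L_fewer_bounding_star_Menger_imp_Menger
      Hurewicz_imp_Menger in blast)+

end
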